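(* For complex parameters $\beta_1,\beta_2$ define the birational map $R(\beta_1,\beta_2):(x,y)\mapsto(p,q)$, with $x=(x^3,x^2)$, $y=(y^3,y^2)$, $p=(p^3,p^2)$, $q=(q^3,q^2)$, by $$(p^3,p^2)=\big(y^3\widetilde P^{-1},\;y^2+x^2(1-\widetilde P)\big),\qquad (q^3,q^2)=(x^3\widetilde P,\;x^2\widetilde P),\qquad \widetilde P=1-\frac{(\beta_1-\beta_2)\,y^3}{1-x^2y^3}.$$ Then: (a) whenever $u,v,u_{(1)},v_{(1)},v_{(2)},u_{(1,2)},v_{(1,2)}$ satisfy $$u_{(1,2)}=u+\frac{\beta_1-\beta_2}{1-u_{(1)}v_{(2)}}u_{(1)},\qquad v_{(1,2)}=v-\frac{\beta_1-\beta_2}{1-u_{(1)}v_{(2)}}v_{(2)},$$ the quantities $x=(v/v_{(1)},\,v\,u_{(1)})$, $y=(v_{(2)}/v,\,u\,v_{(2)})$, $p=(v_{(2)}/v_{(1,2)},\,v_{(2)}u_{(1,2)})$, $q=(v_{(1,2)}/v_{(1)},\,u_{(1)}v_{(1,2)})$ satisfy $(p,q)=R(\beta_1,\beta_2)(x,y)$; (b) $R$ satisfies the parameter-dependent Yang-Baxter relation $$R^{(2,3)}(\beta_2,\beta_3)\,R^{(1,3)}(\beta_1,\beta_3)\,R^{(1,2)}(\beta_1,\beta_2)=R^{(1,2)}(\beta_1,\beta_2)\,R^{(1,3)}(\beta_1,\beta_3)\,R^{(2,3)}(\beta_2,\beta_3).$$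
   Context: Upper indices $2,3$ on $x,y,p,q$ are component labels, not powers (while $\widetilde P^{-1}=1/\widetilde P$). All variables are complex scalars; identities are understood for generic values, where all expressions are defined (equalities of rational maps). $R^{(i,j)}$ acts on triples $(x,y,z)$ of elements of $\mathbb{C}^2$ as $R$ on the $i$-th and $j$-th entries (in this order) and as the identity on the remaining entry; products are compositions. Subscripts in parentheses are just names for the (shifted) field values on the vertices of an elementary square. *)

theory Defs
  imports Complex_Main
begin

text \<open>Rational maps between affine spaces are partial functions: \<open>None\<close> stands for
  a vanishing denominator, and composition is \<^const>\<open>map_comp\<close>.  An affine space is a tuple type
  together with its set \<open>X\<close> of coordinate functions.\<close>

inductive poly_fun :: "('a \<Rightarrow> complex) set \<Rightarrow> ('a \<Rightarrow> complex) \<Rightarrow> bool"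
  for X :: "('a \<Rightarrow> complex) set" where
  coord: "f \<in> X \<Longrightarrow> poly_fun X f"
| const: "poly_fun X (\<lambda>_. c)"
| add: "poly_fun X f \<Longrightarrow> poly_fun X g \<Longrightarrow> poly_fun X (\<lambda>w. f w + g w)"
| mult: "poly_fun X f \<Longrightarrow> poly_fun X g \<Longrightarrow> poly_fun X (\<lambda>w. f w * g w)"

text \<open>A property is generic if it holds off the zero set of a nonzero polynomial,
  i.e. on a nonempty Zariski-open set.\<close>

definition generically :: "('a \<Rightarrow> complex) set \<Rightarrow> ('a \<Rightarrow> bool) \<Rightarrow> bool" where
  "generically X Q \<longleftrightarrow>
     (\<exists>d. poly_fun X d \<and> (\<exists>w. d w \<noteq> 0) \<and> (\<forall>w. d w \<noteq> 0 \<longrightarrow> Q w))"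

definition rational_map ::
  "('a \<Rightarrow> complex) set \<Rightarrow> ('b \<Rightarrow> complex) set \<Rightarrow> ('a \<Rightarrow> 'b option) \<Rightarrow> bool" where
  "rational_map X Y F \<longleftrightarrow>
     (\<forall>c\<in>Y. \<exists>n d. poly_fun X n \<and> poly_fun X d \<and>
        generically X (\<lambda>w. w \<in> dom F \<and> d w \<noteq> 0 \<and> c (the (F w)) = n w / d w))"

text \<open>Both sides are generically defined, so the equality below is never vacuous; and they agree
  at every single point where both are defined.\<close>

definition rational_eq ::
  "('a \<Rightarrow> complex) set \<Rightarrow> ('a \<Rightarrow> 'b option) \<Rightarrow> ('a \<Rightarrow> 'b option) \<Rightarrow> bool" where
  "rational_eq X F G \<longleftrightarrow>
     generically X (\<lambda>w. w \<in> dom F \<inter> dom G) \<and> (\<forall>w \<in> dom F \<inter> dom G. F w = G w)"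

definition birational_map :: "('a \<Rightarrow> complex) set \<Rightarrow> ('a \<Rightarrow> 'a option) \<Rightarrow> bool" where
  "birational_map X F \<longleftrightarrow> rational_map X X F \<and>
     (\<exists>G. rational_map X X G \<and> rational_eq X (G \<circ>\<^sub>m F) Some \<and> rational_eq X (F \<circ>\<^sub>m G) Some)"

text \<open>A point \<open>x = (x\<^sup>3, x\<^sup>2)\<close>: the first component carries the label 3, the second the label 2.\<close>

type_synonym pt = "complex \<times> complex"

definition coords2 :: "(pt \<times> pt \<Rightarrow> complex) set" where
  "coords2 = {\<lambda>(x, y). fst x, \<lambda>(x, y). snd x, \<lambda>(x, y). fst y, \<lambda>(x, y). snd y}"

definition coords3 :: "(pt \<times> pt \<times> pt \<Rightarrow> complex) set" where
  "coords3 = {\<lambda>(x, y, z). fst x, \<lambda>(x, y, z). snd x, \<lambda>(x, y, z). fst y, \<lambda>(x, y, z). snd y,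
              \<lambda>(x, y, z). fst z, \<lambda>(x, y, z). snd z}"

definition Ptilde :: "complex \<Rightarrow> complex \<Rightarrow> pt \<Rightarrow> pt \<Rightarrow> complex" where
  "Ptilde \<beta>1 \<beta>2 = (\<lambda>(x3, x2) (y3, y2). 1 - (\<beta>1 - \<beta>2) * y3 / (1 - x2 * y3))"

definition R :: "complex \<Rightarrow> complex \<Rightarrow> pt \<times> pt \<Rightarrow> (pt \<times> pt) option" where
  "R \<beta>1 \<beta>2 = (\<lambda>((x3, x2), (y3, y2)).
     let P = Ptilde \<beta>1 \<beta>2 (x3, x2) (y3, y2) in
     if 1 - x2 * y3 = 0 \<or> P = 0 then None
     else Some ((y3 * inverse P, y2 + x2 * (1 - P)), (x3 * P, x2 * P)))"

definition on12 :: "(pt \<times> pt \<Rightarrow> (pt \<times> pt) option) \<Rightarrow> pt \<times> pt \<times> pt \<Rightarrow> (pt \<times> pt \<times> pt) option" where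
  "on12 F = (\<lambda>(x, y, z). map_option (\<lambda>(p, q). (p, q, z)) (F (x, y)))"

definition on13 :: "(pt \<times> pt \<Rightarrow> (pt \<times> pt) option) \<Rightarrow> pt \<times> pt \<times> pt \<Rightarrow> (pt \<times> pt \<times> pt) option" where
  "on13 F = (\<lambda>(x, y, z). map_option (\<lambda>(p, q). (p, y, q)) (F (x, z)))"

definition on23 :: "(pt \<times> pt \<Rightarrow> (pt \<times> pt) option) \<Rightarrow> pt \<times> pt \<times> pt \<Rightarrow> (pt \<times> pt \<times> pt) option" where
  "on23 F = (\<lambda>(x, y, z). map_option (\<lambda>(p, q). (x, p, q)) (F (y, z)))"

end

theory Submission
  imports Defs
begin

text \<open>
  \<^emph>\<open>Yang-Baxter relation.\<close> All three maps \<open>R\<close> act through their multipliers, the values of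
  \<^const>\<open>Ptilde\<close>.  Let \<open>P1, P2, P3\<close> be the successive multipliers on the left and \<open>Q1, Q2, Q3\<close>
  those on the right, in order of application, so that \<open>P1\<close>, \<open>Q3\<close> belong to the first two
  entries, \<open>P2\<close>, \<open>Q2\<close> to the outer two and \<open>P3\<close>, \<open>Q1\<close> to the last two.  Written in terms of them,
  the six output coordinates agree as soon as \<open>P1 P3 = Q2\<close>, \<open>P2 = Q1 Q3\<close> and
  \<open>(1 - P1) (1 - P2) = (1 - Q2) (1 - Q3)\<close>.  These relations hold because the denominators that arise
  on the two sides are, up to products and quotients, the same four polynomials (lemma \<open>Ptilde_relations\<close>).

  \<^emph>\<open>Invertibility.\<close> \<open>R\<close> preserves the product \<open>x\<^sup>2 y\<^sup>3 = q\<^sup>2 p\<^sup>3\<close>, so the multiplier can be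
  recovered from the image: exchanging both the two arguments and the two parameters inverts
  \<^const>\<open>Ptilde\<close>, and the inverse of \<open>R(\<beta>1, \<beta>2)\<close> is \<open>R(\<beta>2, \<beta>1)\<close> conjugated by the swap
  (lemma \<open>R_reversible\<close>).

  \<^emph>\<open>Elementary squares.\<close> The multiplier of a square is \<open>v\<^sub>(\<^sub>1\<^sub>,\<^sub>2\<^sub>) / v\<close>, after which the
  formulas for \<open>p\<close> and \<open>q\<close> are direct substitutions (lemma \<open>R_square\<close>).

  \<^emph>\<open>Genericity.\<close> A composition of partially defined rational maps may be defined nowhere.  Here it
  is not, because at the origin the multiplier is 1, so every map involved is regular there
  and fixes the origin.  Maps that are regular at a point compose, so all the compositions are defined
  on a Zariski neighbourhood of the origin; no denominator of a composite has to be computed.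
\<close>

section \<open>Zariski neighbourhoods and regular functions\<close>

definition zariski_nhds :: "('a \<Rightarrow> complex) set \<Rightarrow> 'a \<Rightarrow> 'a filter" where
  "zariski_nhds X a =
     Abs_filter (\<lambda>Q. \<exists>d. poly_fun X d \<and> d a \<noteq> 0 \<and> (\<forall>w. d w \<noteq> 0 \<longrightarrow> Q w))"

lemma eventually_zariski_nhds:
  "eventually Q (zariski_nhds X a) \<longleftrightarrow>
     (\<exists>d. poly_fun X d \<and> d a \<noteq> 0 \<and> (\<forall>w. d w \<noteq> 0 \<longrightarrow> Q w))"
  unfolding zariski_nhds_def
proof (rule eventually_Abs_filter, rule is_filter.intro)
  show "\<exists>d. poly_fun X d \<and> d a \<noteq> 0 \<and> (\<forall>w. d w \<noteq> 0 \<longrightarrow> True)"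
    by (rule exI[of _ "\<lambda>_. 1"]) (auto intro: poly_fun.const)
next
  fix P Q
  assume "\<exists>d. poly_fun X d \<and> d a \<noteq> 0 \<and> (\<forall>w. d w \<noteq> 0 \<longrightarrow> P w)"
    and "\<exists>d. poly_fun X d \<and> d a \<noteq> 0 \<and> (\<forall>w. d w \<noteq> 0 \<longrightarrow> Q w)"
  then obtain d e where "poly_fun X d" "d a \<noteq> 0" "\<forall>w. d w \<noteq> 0 \<longrightarrow> P w"
    and "poly_fun X e" "e a \<noteq> 0" "\<forall>w. e w \<noteq> 0 \<longrightarrow> Q w" by blast
  then show "\<exists>d. poly_fun X d \<and> d a \<noteq> 0 \<and> (\<forall>w. d w \<noteq> 0 \<longrightarrow> P w \<and> Q w)"
    by (intro exI[of _ "\<lambda>w. d w * e w"]) (auto intro: poly_fun.mult)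
qed blast

lemma eventually_zariski_nhds_at:
  "eventually Q (zariski_nhds X a) \<Longrightarrow> Q a"
  by (auto simp: eventually_zariski_nhds)

lemma eventually_imp_generically:
  "eventually Q (zariski_nhds X a) \<Longrightarrow> generically X Q"
  by (auto simp: eventually_zariski_nhds generically_def)

lemma poly_fun_eventually_nonzero:
  "poly_fun X d \<Longrightarrow> d a \<noteq> 0 \<Longrightarrow> eventually (\<lambda>w. d w \<noteq> 0) (zariski_nhds X a)"
  by (auto simp: eventually_zariski_nhds)

definition regular_at :: "('a \<Rightarrow> complex) set \<Rightarrow> 'a \<Rightarrow> ('a \<Rightarrow> complex) \<Rightarrow> bool" where
  "regular_at X a f \<longleftrightarrow> (\<exists>n d. poly_fun X n \<and> poly_fun X d \<and> d a \<noteq> 0 \<and>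
     eventually (\<lambda>w. f w = n w / d w) (zariski_nhds X a))"

lemma regular_at_poly: "poly_fun X f \<Longrightarrow> regular_at X a f"
  unfolding regular_at_def
  by (intro exI[of _ f] exI[of _ "\<lambda>_. 1"]) (auto intro: poly_fun.const)

lemma regular_at_const: "regular_at X a (\<lambda>_. c)"
  by (intro regular_at_poly poly_fun.const)

lemma regular_at_cong:
  assumes "regular_at X a f" "eventually (\<lambda>w. f w = g w) (zariski_nhds X a)"
  shows "regular_at X a g"
proof -
  obtain n d where nd: "poly_fun X n" "poly_fun X d" "d a \<noteq> 0"
    and f: "eventually (\<lambda>w. f w = n w / d w) (zariski_nhds X a)"
    using assms(1) by (auto simp: regular_at_def)
  have "eventually (\<lambda>w. g w = n w / d w) (zariski_nhds X a)"
    using f assms(2) by eventually_elim simp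
  with nd show ?thesis by (auto simp: regular_at_def)
qed

lemma regular_at_add:
  assumes "regular_at X a f" "regular_at X a g"
  shows "regular_at X a (\<lambda>w. f w + g w)"
proof -
  obtain n d where nd: "poly_fun X n" "poly_fun X d" "d a \<noteq> 0"
    and f: "eventually (\<lambda>w. f w = n w / d w) (zariski_nhds X a)"
    using assms(1) by (auto simp: regular_at_def)
  obtain m e where me: "poly_fun X m" "poly_fun X e" "e a \<noteq> 0"
    and g: "eventually (\<lambda>w. g w = m w / e w) (zariski_nhds X a)"
    using assms(2) by (auto simp: regular_at_def)
  have "eventually (\<lambda>w. f w + g w = (n w * e w + m w * d w) / (d w * e w)) (zariski_nhds X a)"
    using f g poly_fun_eventually_nonzero[OF nd(2,3)] poly_fun_eventually_nonzero[OF me(2,3)]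
    by eventually_elim (simp add: add_frac_eq)
  with nd me show ?thesis
    unfolding regular_at_def
    by (intro exI[of _ "\<lambda>w. n w * e w + m w * d w"] exI[of _ "\<lambda>w. d w * e w"])
      (auto intro: poly_fun.add poly_fun.mult)
qed

lemma regular_at_mult:
  assumes "regular_at X a f" "regular_at X a g"
  shows "regular_at X a (\<lambda>w. f w * g w)"
proof -
  obtain n d where nd: "poly_fun X n" "poly_fun X d" "d a \<noteq> 0"
    and f: "eventually (\<lambda>w. f w = n w / d w) (zariski_nhds X a)"
    using assms(1) by (auto simp: regular_at_def)
  obtain m e where me: "poly_fun X m" "poly_fun X e" "e a \<noteq> 0"
    and g: "eventually (\<lambda>w. g w = m w / e w) (zariski_nhds X a)"
    using assms(2) by (auto simp: regular_at_def)
  have "eventually (\<lambda>w. f w * g w = (n w * m w) / (d w * e w)) (zariski_nhds X a)"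
    using f g by eventually_elim simp
  with nd me show ?thesis
    unfolding regular_at_def
    by (intro exI[of _ "\<lambda>w. n w * m w"] exI[of _ "\<lambda>w. d w * e w"]) (auto intro: poly_fun.mult)
qed

lemma regular_at_diff:
  assumes "regular_at X a f" "regular_at X a g"
  shows "regular_at X a (\<lambda>w. f w - g w)"
  using regular_at_add[OF assms(1) regular_at_mult[OF regular_at_const[of X a "-1"] assms(2)]]
  by simp

lemma regular_at_inverse:
  assumes "regular_at X a f" "f a \<noteq> 0"
  shows "regular_at X a (\<lambda>w. inverse (f w))"
proof -
  obtain n d where nd: "poly_fun X n" "poly_fun X d" "d a \<noteq> 0"
    and f: "eventually (\<lambda>w. f w = n w / d w) (zariski_nhds X a)"
    using assms(1) by (auto simp: regular_at_def)
  have "n a \<noteq> 0" using eventually_zariski_nhds_at[OF f] assms(2) by auto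
  moreover have "eventually (\<lambda>w. inverse (f w) = d w / n w) (zariski_nhds X a)"
    using f by eventually_elim simp
  ultimately show ?thesis using nd by (auto simp: regular_at_def)
qed

lemma regular_at_divide:
  assumes "regular_at X a f" "regular_at X a g" "g a \<noteq> 0"
  shows "regular_at X a (\<lambda>w. f w / g w)"
  using regular_at_mult[OF assms(1) regular_at_inverse[OF assms(2,3)]]
  by (simp add: divide_inverse)

lemma regular_at_eventually_nonzero:
  assumes "regular_at X a f" "f a \<noteq> 0"
  shows "eventually (\<lambda>w. f w \<noteq> 0) (zariski_nhds X a)"
proof -
  obtain n d where nd: "poly_fun X n" "poly_fun X d" "d a \<noteq> 0"
    and f: "eventually (\<lambda>w. f w = n w / d w) (zariski_nhds X a)"
    using assms(1) by (auto simp: regular_at_def)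
  have "n a \<noteq> 0" using eventually_zariski_nhds_at[OF f] assms(2) by auto
  from f poly_fun_eventually_nonzero[OF nd(1) this] poly_fun_eventually_nonzero[OF nd(2,3)]
  show ?thesis by eventually_elim simp
qed

lemma regular_at_poly_comp:
  assumes "poly_fun Y p" "\<And>c. c \<in> Y \<Longrightarrow> regular_at X a (\<lambda>w. c (h w))"
  shows "regular_at X a (\<lambda>w. p (h w))"
  using assms(1)
  by induction (auto intro: assms(2) regular_at_const regular_at_add regular_at_mult)

text \<open>Regular maps are continuous for the Zariski topology, as the pullback of a polynomial that is
  nonzero at the image point is regular and nonzero at the original point.\<close>

lemma eventually_zariski_nhds_comp:
  assumes h: "\<And>c. c \<in> Y \<Longrightarrow> regular_at X a (\<lambda>w. c (h w))"
    and "eventually Q (zariski_nhds Y (h a))"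
  shows "eventually (\<lambda>w. Q (h w)) (zariski_nhds X a)"
proof -
  obtain d where d: "poly_fun Y d" "d (h a) \<noteq> 0" "\<And>w. d w \<noteq> 0 \<Longrightarrow> Q w"
    using assms(2) by (auto simp: eventually_zariski_nhds)
  have "regular_at X a (\<lambda>w. d (h w))"
    using d(1) h by (rule regular_at_poly_comp)
  from regular_at_eventually_nonzero[OF this d(2)]
  show ?thesis by eventually_elim (rule d(3))
qed

lemma regular_at_comp:
  assumes h: "\<And>c. c \<in> Y \<Longrightarrow> regular_at X a (\<lambda>w. c (h w))"
    and "regular_at Y (h a) f"
  shows "regular_at X a (\<lambda>w. f (h w))"
proof -
  obtain n d where nd: "poly_fun Y n" "poly_fun Y d" "d (h a) \<noteq> 0"
    and f: "eventually (\<lambda>w. f w = n w / d w) (zariski_nhds Y (h a))"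
    using assms(2) by (auto simp: regular_at_def)
  have "eventually (\<lambda>w. n (h w) / d (h w) = f (h w)) (zariski_nhds X a)"
    using eventually_zariski_nhds_comp[of Y X a h "\<lambda>w. f w = n w / d w"] h f
    by (simp add: eq_commute)
  moreover have "regular_at X a (\<lambda>w. n (h w) / d (h w))"
    using regular_at_poly_comp[OF nd(1), of X a h] regular_at_poly_comp[OF nd(2), of X a h] h nd(3)
    by (intro regular_at_divide[where f = "\<lambda>w. n (h w)" and g = "\<lambda>w. d (h w)"]) simp_all
  ultimately show ?thesis by (rule regular_at_cong[rotated])
qed

section \<open>Partial maps that are regular at a point\<close>

text \<open>The image point is part of the notion, so that compositions chain.\<close>

definition regular_map_at ::
  "('a \<Rightarrow> complex) set \<Rightarrow> ('b \<Rightarrow> complex) set \<Rightarrow> 'a \<Rightarrow> 'b \<Rightarrow> ('a \<Rightarrow> 'b option) \<Rightarrow> bool" where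
  "regular_map_at X Y a b F \<longleftrightarrow> F a = Some b \<and>
     eventually (\<lambda>w. w \<in> dom F) (zariski_nhds X a) \<and>
     (\<forall>c\<in>Y. regular_at X a (\<lambda>w. c (the (F w))))"

lemma regular_map_at_comp:
  assumes "regular_map_at X Y a b F" "regular_map_at Y Z b e G"
  shows "regular_map_at X Z a e (G \<circ>\<^sub>m F)"
proof -
  let ?h = "\<lambda>w. the (F w)"
  have h: "\<And>c. c \<in> Y \<Longrightarrow> regular_at X a (\<lambda>w. c (?h w))" and ha: "?h a = b"
    and domF: "eventually (\<lambda>w. w \<in> dom F) (zariski_nhds X a)"
    using assms(1) by (auto simp: regular_map_at_def)
  have domG: "eventually (\<lambda>w. ?h w \<in> dom G) (zariski_nhds X a)"
    using eventually_zariski_nhds_comp[of Y X a ?h "\<lambda>w. w \<in> dom G", OF h] assms(2)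
    by (auto simp: regular_map_at_def ha)
  have "regular_at X a (\<lambda>w. c (the ((G \<circ>\<^sub>m F) w)))" if "c \<in> Z" for c
  proof (rule regular_at_cong)
    show "regular_at X a (\<lambda>w. c (the (G (?h w))))"
      using regular_at_comp[of Y X a ?h "\<lambda>w. c (the (G w))", OF h] assms(2) that
      by (auto simp: regular_map_at_def ha)
    show "eventually (\<lambda>w. c (the (G (?h w))) = c (the ((G \<circ>\<^sub>m F) w))) (zariski_nhds X a)"
      using domF by eventually_elim (auto simp: map_comp_def)
  qed
  moreover have "eventually (\<lambda>w. w \<in> dom (G \<circ>\<^sub>m F)) (zariski_nhds X a)"
    using domF domG by eventually_elim (auto simp: map_comp_def)
  ultimately show ?thesis
    using assms by (auto simp: regular_map_at_def)
qed

lemma regular_map_at_imp_rational_map: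
  assumes "regular_map_at X Y a b F"
  shows "rational_map X Y F"
  unfolding rational_map_def
proof
  fix c assume "c \<in> Y"
  then obtain n d where nd: "poly_fun X n" "poly_fun X d" "d a \<noteq> 0"
    and c: "eventually (\<lambda>w. c (the (F w)) = n w / d w) (zariski_nhds X a)"
    using assms by (auto simp: regular_map_at_def regular_at_def)
  have "eventually (\<lambda>w. w \<in> dom F) (zariski_nhds X a)"
    using assms by (auto simp: regular_map_at_def)
  then have "eventually (\<lambda>w. w \<in> dom F \<and> d w \<noteq> 0 \<and> c (the (F w)) = n w / d w) (zariski_nhds X a)"
    using c poly_fun_eventually_nonzero[OF nd(2,3)] by eventually_elim blast
  then show "\<exists>n d. poly_fun X n \<and> poly_fun X d \<and>
      generically X (\<lambda>w. w \<in> dom F \<and> d w \<noteq> 0 \<and> c (the (F w)) = n w / d w)"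
    using nd(1,2) by (intro exI conjI) (assumption | erule eventually_imp_generically)+
qed

lemma regular_map_at_imp_rational_eq:
  assumes "regular_map_at X Y a b F" "regular_map_at X Y a b' G"
    and "\<And>w s t. F w = Some s \<Longrightarrow> G w = Some t \<Longrightarrow> s = t"
  shows "rational_eq X F G"
proof -
  have "eventually (\<lambda>w. w \<in> dom F) (zariski_nhds X a)"
    and "eventually (\<lambda>w. w \<in> dom G) (zariski_nhds X a)"
    using assms(1,2) by (auto simp: regular_map_at_def)
  then have "eventually (\<lambda>w. w \<in> dom F \<inter> dom G) (zariski_nhds X a)"
    by eventually_elim simp
  then have "generically X (\<lambda>w. w \<in> dom F \<inter> dom G)"
    by (rule eventually_imp_generically)
  then show ?thesis
    unfolding rational_eq_def using assms(3) by force
qed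

lemma regular_map_at_total:
  assumes "\<And>c. c \<in> Y \<Longrightarrow> poly_fun X (\<lambda>w. c (h w))" "h a = b"
  shows "regular_map_at X Y a b (\<lambda>w. Some (h w))"
  using assms by (auto simp: regular_map_at_def intro: regular_at_poly)

section \<open>Regularity of the maps at the origin\<close>

lemma coords2_eq: "coords2 =
    {\<lambda>w. fst (fst w), \<lambda>w. snd (fst w), \<lambda>w. fst (snd w), \<lambda>w. snd (snd w)}"
  unfolding coords2_def by (simp add: case_prod_beta')

lemma coords3_eq: "coords3 =
    {\<lambda>w. fst (fst w), \<lambda>w. snd (fst w), \<lambda>w. fst (fst (snd w)), \<lambda>w. snd (fst (snd w)),
     \<lambda>w. fst (snd (snd w)), \<lambda>w. snd (snd (snd w))}"
  unfolding coords3_def by (simp add: case_prod_beta')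

lemma poly_fun_coords2:
  "poly_fun coords2 (\<lambda>w. fst (fst w))" "poly_fun coords2 (\<lambda>w. snd (fst w))"
  "poly_fun coords2 (\<lambda>w. fst (snd w))" "poly_fun coords2 (\<lambda>w. snd (snd w))"
  by (rule poly_fun.coord, simp add: coords2_eq)+

lemma poly_fun_coords3:
  "poly_fun coords3 (\<lambda>w. fst (fst w))" "poly_fun coords3 (\<lambda>w. snd (fst w))"
  "poly_fun coords3 (\<lambda>w. fst (fst (snd w)))" "poly_fun coords3 (\<lambda>w. snd (fst (snd w)))"
  "poly_fun coords3 (\<lambda>w. fst (snd (snd w)))" "poly_fun coords3 (\<lambda>w. snd (snd (snd w)))"
  by (rule poly_fun.coord, simp add: coords3_eq)+

abbreviation origin2 :: "pt \<times> pt" where "origin2 \<equiv> ((0, 0), (0, 0))"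
abbreviation origin3 :: "pt \<times> pt \<times> pt" where "origin3 \<equiv> ((0, 0), (0, 0), (0, 0))"

lemma R_regular: "regular_map_at coords2 coords2 origin2 origin2 (R \<beta>1 \<beta>2)"
proof -
  define D :: "pt \<times> pt \<Rightarrow> complex" where "D = (\<lambda>w. 1 - snd (fst w) * fst (snd w))"
  define P where "P = (\<lambda>w. 1 - (\<beta>1 - \<beta>2) * fst (snd w) / D w)"
  let ?o = "origin2"
  have R_eq: "R \<beta>1 \<beta>2 w = (if D w = 0 \<or> P w = 0 then None
     else Some ((fst (snd w) * inverse (P w), snd (snd w) + snd (fst w) * (1 - P w)),
                (fst (fst w) * P w, snd (fst w) * P w)))" for w
    by (simp add: R_def Ptilde_def D_def P_def Let_def case_prod_beta')
  note coord = poly_fun_coords2[THEN regular_at_poly]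
  note intros = regular_at_const regular_at_add regular_at_diff regular_at_mult
    regular_at_divide regular_at_inverse coord
  have D: "regular_at coords2 ?o D" unfolding D_def by (intro intros)
  have Do: "D ?o \<noteq> 0" by (simp add: D_def)
  have P: "regular_at coords2 ?o P" unfolding P_def by (intro intros D Do)
  have Po: "P ?o \<noteq> 0" by (simp add: P_def)
  have ev: "eventually (\<lambda>w. D w \<noteq> 0 \<and> P w \<noteq> 0) (zariski_nhds coords2 ?o)"
    using regular_at_eventually_nonzero[OF D Do] regular_at_eventually_nonzero[OF P Po]
    by eventually_elim blast
  have "regular_at coords2 ?o (\<lambda>w. c (the (R \<beta>1 \<beta>2 w)))" if "c \<in> coords2" for c
  proof (rule regular_at_cong)
    let ?v = "\<lambda>w. ((fst (snd w) * inverse (P w), snd (snd w) + snd (fst w) * (1 - P w)),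
                (fst (fst w) * P w, snd (fst w) * P w))"
    show "regular_at coords2 ?o (\<lambda>w. c (?v w))"
      using that unfolding coords2_eq[THEN eqset_imp_iff]
      by (elim insertE emptyE) (simp_all, (intro intros P Po)+)
    show "eventually (\<lambda>w. c (?v w) = c (the (R \<beta>1 \<beta>2 w))) (zariski_nhds coords2 ?o)"
      using ev by eventually_elim (simp add: R_eq)
  qed
  moreover have "eventually (\<lambda>w. w \<in> dom (R \<beta>1 \<beta>2)) (zariski_nhds coords2 ?o)"
    using ev by eventually_elim (simp add: R_eq dom_def)
  ultimately show ?thesis
    using Do Po by (simp add: regular_map_at_def R_eq)
qed

text \<open>The three embeddings \<^const>\<open>on12\<close>, \<^const>\<open>on13\<close>, \<^const>\<open>on23\<close> are instances of one
  construction: project to a pair by \<open>h\<close>, apply \<open>F\<close>, and reassemble the result with the original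
  point by \<open>k\<close>, each coordinate of which is a coordinate of one of its two arguments.\<close>

lemma regular_map_at_embed:
  assumes F: "regular_map_at coords2 coords2 origin2 origin2 F"
    and L: "\<And>w. L w = map_option (k w) (F (h w))"
    and h: "\<And>c. c \<in> coords2 \<Longrightarrow> (\<lambda>w. c (h w)) \<in> coords3"
    and k: "\<And>c. c \<in> coords3 \<Longrightarrow>
      (\<exists>e\<in>coords2. \<forall>w v. c (k w v) = e v) \<or> (\<exists>e\<in>coords3. \<forall>w v. c (k w v) = e w)"
    and "h origin3 = origin2" "k origin3 origin2 = origin3"
  shows "regular_map_at coords3 coords3 origin3 origin3 L"
proof -
  have h': "regular_at coords3 origin3 (\<lambda>w. c (h w))" if "c \<in> coords2" for c
    using h[OF that] by (intro regular_at_poly poly_fun.coord)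
  have ev: "eventually (\<lambda>w. h w \<in> dom F) (zariski_nhds coords3 origin3)"
    using eventually_zariski_nhds_comp[of coords2 coords3 origin3 h "\<lambda>w. w \<in> dom F", OF h'] F assms(5)
    by (simp add: regular_map_at_def)
  have "regular_at coords3 origin3 (\<lambda>w. c (the (L w)))" if "c \<in> coords3" for c
  proof (rule regular_at_cong)
    show "regular_at coords3 origin3 (\<lambda>w. c (k w (the (F (h w)))))"
      using k[OF that]
    proof (elim disjE bexE)
      fix e assume e: "e \<in> coords2" "\<forall>w v. c (k w v) = e v"
      then show ?thesis
        using regular_at_comp[of coords2 coords3 origin3 h "\<lambda>w. e (the (F w))", OF h'] F assms(5)
        by (simp add: regular_map_at_def del: split_paired_All)
    next
      fix e assume "e \<in> coords3" "\<forall>w v. c (k w v) = e w"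
      then show ?thesis by (simp add: regular_at_poly poly_fun.coord del: split_paired_All)
    qed
    show "eventually (\<lambda>w. c (k w (the (F (h w)))) = c (the (L w))) (zariski_nhds coords3 origin3)"
      using ev by eventually_elim (auto simp: L)
  qed
  moreover have "eventually (\<lambda>w. w \<in> dom L) (zariski_nhds coords3 origin3)"
    using ev by eventually_elim (auto simp: L)
  ultimately show ?thesis
    using F assms(5,6) by (simp add: regular_map_at_def L)
qed

lemma on12_regular:
  assumes "regular_map_at coords2 coords2 origin2 origin2 F"
  shows "regular_map_at coords3 coords3 origin3 origin3 (on12 F)"
  by (rule regular_map_at_embed[OF assms, where
        h = "\<lambda>w. (fst w, fst (snd w))" and k = "\<lambda>w v. (fst v, snd v, snd (snd w))"])
    (auto simp: on12_def coords2_eq coords3_eq case_prod_beta')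

lemma on13_regular:
  assumes "regular_map_at coords2 coords2 origin2 origin2 F"
  shows "regular_map_at coords3 coords3 origin3 origin3 (on13 F)"
  by (rule regular_map_at_embed[OF assms, where
        h = "\<lambda>w. (fst w, snd (snd w))" and k = "\<lambda>w v. (fst v, fst (snd w), snd v)"])
    (auto simp: on13_def coords2_eq coords3_eq case_prod_beta')

lemma on23_regular:
  assumes "regular_map_at coords2 coords2 origin2 origin2 F"
  shows "regular_map_at coords3 coords3 origin3 origin3 (on23 F)"
  by (rule regular_map_at_embed[OF assms, where
        h = "\<lambda>w. (fst (snd w), snd (snd w))" and k = "\<lambda>w v. (fst w, fst v, snd v)"])
    (auto simp: on23_def coords2_eq coords3_eq case_prod_beta')

section \<open>Birationality\<close>

lemma R_eq_Some_iff:
  "R \<beta>1 \<beta>2 ((x3, x2), (y3, y2)) = Some w \<longleftrightarrow>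
     (\<exists>P. P = 1 - (\<beta>1 - \<beta>2) * y3 / (1 - x2 * y3) \<and> 1 - x2 * y3 \<noteq> 0 \<and> P \<noteq> 0 \<and>
        w = ((y3 / P, y2 + x2 * (1 - P)), (x3 * P, x2 * P)))"
  by (auto simp: R_def Ptilde_def Let_def divide_inverse)

text \<open>Since \<open>q\<^sup>2 p\<^sup>3 = x\<^sup>2 y\<^sup>3\<close>, the reversed map has the same denominator, and its multiplier
  \<open>1 + (\<beta>1 - \<beta>2) p\<^sup>3 / (1 - q\<^sup>2 p\<^sup>3)\<close> with \<open>p\<^sup>3 = y\<^sup>3 / P\<close> equals \<open>1 + (1 - P) / P = 1 / P\<close>.\<close>

lemma R_reversible:
  assumes "R \<beta>1 \<beta>2 (x, y) = Some (p, q)"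
  shows "R \<beta>2 \<beta>1 (q, p) = Some (y, x)"
proof -
  obtain x3 x2 y3 y2 where xy: "x = (x3, x2)" "y = (y3, y2)" by (cases x, cases y)
  obtain P where P: "P = 1 - (\<beta>1 - \<beta>2) * y3 / (1 - x2 * y3)" "1 - x2 * y3 \<noteq> 0" "P \<noteq> 0"
    and pq: "p = (y3 / P, y2 + x2 * (1 - P))" "q = (x3 * P, x2 * P)"
    using assms unfolding xy R_eq_Some_iff by blast
  have den: "x2 * P * (y3 / P) = x2 * y3" using P(3) by simp
  have "(\<beta>2 - \<beta>1) * (y3 / P) / (1 - x2 * y3) = - ((\<beta>1 - \<beta>2) * y3 / (1 - x2 * y3)) / P"
    by (simp add: minus_divide_left minus_mult_left mult.commute[of P])
  also have "\<dots> = (P - 1) / P" using P(1) by simp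
  finally have "(\<beta>2 - \<beta>1) * (y3 / P) / (1 - x2 * P * (y3 / P)) = (P - 1) / P"
    unfolding den .
  then have "inverse P = 1 - (\<beta>2 - \<beta>1) * (y3 / P) / (1 - x2 * P * (y3 / P))"
    using P(3) by (simp add: field_simps)
  then show ?thesis
    unfolding xy pq R_eq_Some_iff using P(2,3)
    by (intro exI[of _ "inverse P"]) (auto simp: field_simps)
qed

lemma R_birational: "birational_map coords2 (R \<beta>1 \<beta>2)"
proof -
  let ?s = "\<lambda>w :: pt \<times> pt. Some (snd w, fst w)"
  let ?G = "?s \<circ>\<^sub>m R \<beta>2 \<beta>1 \<circ>\<^sub>m ?s"
  have id: "regular_map_at coords2 coords2 origin2 origin2 Some"
    using regular_map_at_total[of coords2 coords2 "\<lambda>w. w"] by (simp add: poly_fun.coord)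
  have s: "regular_map_at coords2 coords2 origin2 origin2 ?s"
    by (rule regular_map_at_total) (auto simp: coords2_eq[THEN eqset_imp_iff] intro: poly_fun_coords2)
  have G: "regular_map_at coords2 coords2 origin2 origin2 ?G"
    by (rule regular_map_at_comp[OF s regular_map_at_comp[OF R_regular s]])
  have G_Some: "?G (p, q) = Some (x, y) \<longleftrightarrow> R \<beta>2 \<beta>1 (q, p) = Some (y, x)" for p q x y
    by (cases x; cases y) (auto simp: map_comp_Some_iff)
  have "rational_eq coords2 (?G \<circ>\<^sub>m R \<beta>1 \<beta>2) Some"
  proof (rule regular_map_at_imp_rational_eq[OF regular_map_at_comp[OF R_regular G] id])
    fix w s t :: "pt \<times> pt"
    assume st: "(?G \<circ>\<^sub>m R \<beta>1 \<beta>2) w = Some s" "Some w = Some t"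
    then obtain v where v: "R \<beta>1 \<beta>2 w = Some v" "?G v = Some s"
      using map_comp_Some_iff[of ?G "R \<beta>1 \<beta>2" w s] by blast
    have "?G v = Some w"
      using R_reversible[of \<beta>1 \<beta>2 "fst w" "snd w" "fst v" "snd v"] v(1) by simp
    with v(2) st(2) show "s = t" by simp
  qed
  moreover have "rational_eq coords2 (R \<beta>1 \<beta>2 \<circ>\<^sub>m ?G) Some"
  proof (rule regular_map_at_imp_rational_eq[OF regular_map_at_comp[OF G R_regular] id])
    fix w s t :: "pt \<times> pt"
    assume st: "(R \<beta>1 \<beta>2 \<circ>\<^sub>m ?G) w = Some s" "Some w = Some t"
    then obtain v where v: "?G w = Some v" "R \<beta>1 \<beta>2 v = Some s"
      using map_comp_Some_iff[of "R \<beta>1 \<beta>2" ?G w s] by blast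
    have "R \<beta>2 \<beta>1 (snd w, fst w) = Some (snd v, fst v)"
      using v(1) G_Some[of "fst w" "snd w" "fst v" "snd v"] by simp
    then have "R \<beta>1 \<beta>2 v = Some w"
      using R_reversible[of \<beta>2 \<beta>1 "snd w" "fst w" "snd v" "fst v"] by simp
    with v(2) st(2) show "s = t" by simp
  qed
  ultimately show ?thesis
    unfolding birational_map_def
    by (intro conjI exI[of _ ?G] regular_map_at_imp_rational_map[OF R_regular]
        regular_map_at_imp_rational_map[OF G])
qed

section \<open>Elementary squares\<close>

text \<open>In the variables of a square the denominator is \<open>1 - x\<^sup>2 y\<^sup>3 = 1 - u\<^sub>(\<^sub>1\<^sub>) v\<^sub>(\<^sub>2\<^sub>)\<close> and
  the equation for \<open>v\<^sub>(\<^sub>1\<^sub>,\<^sub>2\<^sub>)\<close> says that the multiplier is \<open>v\<^sub>(\<^sub>1\<^sub>,\<^sub>2\<^sub>) / v\<close>.\<close>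

lemma R_square:
  fixes u v u1 v1 v2 u12 v12 :: complex
  assumes nz: "1 - u1 * v2 \<noteq> 0" "v \<noteq> 0" "v1 \<noteq> 0" "v12 \<noteq> 0"
    and u12: "u12 = u + (\<beta>1 - \<beta>2) / (1 - u1 * v2) * u1"
    and v12: "v12 = v - (\<beta>1 - \<beta>2) / (1 - u1 * v2) * v2"
  shows "R \<beta>1 \<beta>2 ((v / v1, v * u1), (v2 / v, u * v2))
           = Some ((v2 / v12, v2 * u12), (v12 / v1, u1 * v12))"
proof -
  define k where "k = (\<beta>1 - \<beta>2) / (1 - u1 * v2)"
  have v12': "v12 = v - k * v2" and u12': "u12 = u + k * u1"
    using u12 v12 by (simp_all add: k_def)
  have den: "v * u1 * (v2 / v) = u1 * v2" using nz by simp
  have "(\<beta>1 - \<beta>2) * (v2 / v) / (1 - u1 * v2) = k * v2 / v"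
    by (simp add: k_def)
  then have "v12 / v = 1 - (\<beta>1 - \<beta>2) * (v2 / v) / (1 - u1 * v2)"
    using nz(2) by (simp add: v12' diff_divide_distrib)
  moreover have "v2 * u12 = u * v2 + v * u1 * (1 - v12 / v)"
    using nz(2) by (simp add: u12' v12' field_simps)
  moreover have "v2 / v / (v12 / v) = v2 / v12" "v / v1 * (v12 / v) = v12 / v1"
    "v * u1 * (v12 / v) = u1 * v12" "v12 / v \<noteq> 0"
    using nz by simp_all
  ultimately show ?thesis
    unfolding R_eq_Some_iff den using nz(1) by metis
qed

section \<open>The Yang-Baxter relation\<close>

text \<open>With \<open>a = \<beta>1 - \<beta>2\<close> and \<open>b = \<beta>2 - \<beta>3\<close>, the hypotheses are the equations of the multipliers of
  the six steps.  The polynomials \<open>D, E\<close> are the denominators of the first step on either side, and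
  \<open>S, T\<close> those, cleared of fractions, of the second step on the left and on the right.  On either
  side the denominator of the third step involves the one of the second step on the other:
  it is \<open>D T / S\<close> on the left and \<open>E S / T\<close> on the right.  Both products in the last relation
  equal \<open>a (a + b) y\<^sup>3 z\<^sup>3 / S\<close>.\<close>

lemma Ptilde_relations:
  fixes a b x2 y2 y3 z3 :: complex
  assumes D0: "1 - x2 * y3 \<noteq> 0" and E0: "1 - y2 * z3 \<noteq> 0"
    and P1: "P1 = 1 - a * y3 / (1 - x2 * y3)" "P1 \<noteq> 0"
    and P2: "P2 = 1 - (a + b) * z3 / (1 - (y2 + x2 * (1 - P1)) * z3)"
      "1 - (y2 + x2 * (1 - P1)) * z3 \<noteq> 0"
    and P3: "P3 = 1 - b * (y3 / P1 * P2) / (1 - x2 * P1 * (y3 / P1 * P2))"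
    and Q1: "Q1 = 1 - b * z3 / (1 - y2 * z3)" "Q1 \<noteq> 0"
    and Q2: "Q2 = 1 - (a + b) * (y3 * Q1) / (1 - x2 * (y3 * Q1))"
      "1 - x2 * (y3 * Q1) \<noteq> 0"
    and Q3: "Q3 = 1 - a * (z3 / Q1) / (1 - (y2 * Q1 + x2 * (1 - Q2)) * (z3 / Q1))"
  shows "P1 * P3 = Q2" "P2 = Q1 * Q3" "(1 - P1) * (1 - P2) = (1 - Q2) * (1 - Q3)"
proof -
  define D where "D = 1 - x2 * y3"
  define E where "E = 1 - y2 * z3"
  define S where "S = D * E - a * (x2 * y3 * z3)"
  define T where "T = D * E + b * (x2 * y3 * z3)"
  define N where "N = D - a * y3"
  define M where "M = E - b * z3"
  define B where "B = S - (a + b) * z3 * D"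
  have nz: "D \<noteq> 0" "E \<noteq> 0" using D0 E0 by (simp_all add: D_def E_def)
  have xy: "x2 * y3 = 1 - D" and yz: "y2 * z3 = 1 - E" by (simp_all add: D_def E_def)
  have P1': "P1 = N / D" using P1(1) nz by (simp add: N_def D_def[symmetric] diff_divide_distrib)
  have Q1': "Q1 = M / E" using Q1(1) nz by (simp add: M_def E_def[symmetric] diff_divide_distrib)
  have N0: "N \<noteq> 0" and M0: "M \<noteq> 0" using P1(2) Q1(2) P1' Q1' by auto
  have "1 - (y2 + x2 * (1 - P1)) * z3 = E - x2 * z3 * (1 - P1)"
    by (simp add: E_def algebra_simps)
  also have "\<dots> = S / D"
    using nz by (simp add: P1' N_def S_def field_simps)
  finally have den2: "1 - (y2 + x2 * (1 - P1)) * z3 = S / D" .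
  have S0: "S \<noteq> 0" using P2(2) unfolding den2 by simp
  have P2': "P2 = B / S"
    using P2(1) S0 nz unfolding den2 by (simp add: B_def field_simps)
  have "1 - x2 * (y3 * Q1) = 1 - (1 - D) * Q1" by (simp add: xy[symmetric] mult.assoc)
  also have "\<dots> = (E - (1 - D) * M) / E" using nz by (simp add: Q1' field_simps)
  also have "E - (1 - D) * M = T" by (simp add: T_def M_def xy algebra_simps)
  finally have den2': "1 - x2 * (y3 * Q1) = T / E" .
  have T0: "T \<noteq> 0" using Q2(2) unfolding den2' by simp
  have Q2': "1 - Q2 = (a + b) * y3 * M / T"
    using Q2(1) T0 nz unfolding den2' by (simp add: Q1')
  have "1 - x2 * P1 * (y3 / P1 * P2) = 1 - (1 - D) * P2"
    using P1(2) by (simp add: xy[symmetric])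
  also have "\<dots> = (S - (1 - D) * B) / S" using S0 by (simp add: P2' field_simps)
  also have "S - (1 - D) * B = D * T"
    by (simp add: B_def S_def T_def xy algebra_simps)
  finally have den3: "1 - x2 * P1 * (y3 / P1 * P2) = D * T / S" .
  have P3': "P3 = 1 - b * y3 * B / (N * T)"
    using P3 nz N0 S0 T0 unfolding den3 by (simp add: P1' P2')
  have "1 - (y2 * Q1 + x2 * (1 - Q2)) * (z3 / Q1) = E - x2 * z3 * (1 - Q2) / Q1"
    using Q1(2) by (simp add: E_def field_simps)
  also have "\<dots> = E * (T - (a + b) * (x2 * y3 * z3)) / T"
    using nz M0 T0 by (simp add: Q1' Q2' field_simps)
  also have "T - (a + b) * (x2 * y3 * z3) = S"
    by (simp add: S_def T_def algebra_simps)
  finally have den3': "1 - (y2 * Q1 + x2 * (1 - Q2)) * (z3 / Q1) = E * S / T" .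
  have Q3': "1 - Q3 = a * z3 * T / (M * S)"
    using Q3 nz M0 S0 T0 unfolding den3' by (simp add: Q1')
  show "P1 * P3 = Q2"
  proof -
    have "N * T - b * y3 * B = D * (T - (a + b) * y3 * M)"
      by (simp add: N_def M_def B_def S_def T_def algebra_simps)
    then have "(N * T - b * y3 * B) / (D * T) = (T - (a + b) * y3 * M) / T"
      using nz T0 by simp
    moreover have "P1 * P3 = (N * T - b * y3 * B) / (D * T)"
      using nz N0 T0 by (simp add: P1' P3' field_simps)
    moreover have "Q2 = (T - (a + b) * y3 * M) / T"
      using Q2' T0 by (simp add: field_simps)
    ultimately show ?thesis by simp
  qed
  show "P2 = Q1 * Q3"
  proof -
    have "M * S - a * z3 * T = B * E"
      by (simp add: M_def B_def S_def T_def algebra_simps)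
    then have "(M * S - a * z3 * T) / (E * S) = B / S"
      using nz S0 by simp
    moreover have "Q3 = (M * S - a * z3 * T) / (M * S)"
      using Q3' M0 S0 by (simp add: field_simps)
    ultimately show ?thesis using M0 by (simp add: P2' Q1')
  qed
  show "(1 - P1) * (1 - P2) = (1 - Q2) * (1 - Q3)"
  proof -
    have "1 - P1 = a * y3 / D" using nz by (simp add: P1' N_def field_simps)
    moreover have "1 - P2 = (a + b) * z3 * D / S" using S0 by (simp add: P2' B_def field_simps)
    ultimately show ?thesis using nz M0 S0 T0 by (simp add: Q2' Q3')
  qed
qed

lemma R_yang_baxter_pointwise:
  assumes "(on23 (R \<beta>2 \<beta>3) \<circ>\<^sub>m on13 (R \<beta>1 \<beta>3) \<circ>\<^sub>m on12 (R \<beta>1 \<beta>2)) w = Some s"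
    and "(on12 (R \<beta>1 \<beta>2) \<circ>\<^sub>m on13 (R \<beta>1 \<beta>3) \<circ>\<^sub>m on23 (R \<beta>2 \<beta>3)) w = Some t"
  shows "s = t"
proof -
  obtain x3 x2 y3 y2 z3 z2 where w: "w = ((x3, x2), (y3, y2), (z3, z2))"
    by (metis prod.exhaust)
  define a where "a = \<beta>1 - \<beta>2"
  define b where "b = \<beta>2 - \<beta>3"
  have ab: "\<beta>1 - \<beta>2 = a" "\<beta>2 - \<beta>3 = b" "\<beta>1 - \<beta>3 = a + b" by (simp_all add: a_def b_def)
  obtain p q s1 r s2 s3 where
    R12: "R \<beta>1 \<beta>2 ((x3, x2), (y3, y2)) = Some (p, q)" and
    R13: "R \<beta>1 \<beta>3 (p, (z3, z2)) = Some (s1, r)" and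
    R23: "R \<beta>2 \<beta>3 (q, r) = Some (s2, s3)" and
    s: "s = (s1, s2, s3)"
    using assms(1) by (auto simp: w map_comp_Some_iff on12_def on13_def on23_def)
  obtain P1 where
    P1: "P1 = 1 - a * y3 / (1 - x2 * y3)" "1 - x2 * y3 \<noteq> 0" "P1 \<noteq> 0" and
    pq: "p = (y3 / P1, y2 + x2 * (1 - P1))" "q = (x3 * P1, x2 * P1)"
    using R12 unfolding R_eq_Some_iff ab by blast
  obtain P2 where
    P2: "P2 = 1 - (a + b) * z3 / (1 - (y2 + x2 * (1 - P1)) * z3)"
      "1 - (y2 + x2 * (1 - P1)) * z3 \<noteq> 0" and
    s1r: "s1 = (z3 / P2, z2 + (y2 + x2 * (1 - P1)) * (1 - P2))"
      "r = (y3 / P1 * P2, (y2 + x2 * (1 - P1)) * P2)"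
    using R13 unfolding pq R_eq_Some_iff ab by blast
  obtain P3 where
    P3: "P3 = 1 - b * (y3 / P1 * P2) / (1 - x2 * P1 * (y3 / P1 * P2))" and
    s23: "s2 = (y3 / P1 * P2 / P3, (y2 + x2 * (1 - P1)) * P2 + x2 * P1 * (1 - P3))"
      "s3 = (x3 * P1 * P3, x2 * P1 * P3)"
    using R23 unfolding pq s1r R_eq_Some_iff ab by blast
  obtain q' r' x' t3 t1 t2 where
    R23': "R \<beta>2 \<beta>3 ((y3, y2), (z3, z2)) = Some (q', r')" and
    R13': "R \<beta>1 \<beta>3 ((x3, x2), r') = Some (x', t3)" and
    R12': "R \<beta>1 \<beta>2 (x', q') = Some (t1, t2)" and
    t: "t = (t1, t2, t3)"
    using assms(2) by (auto simp: w map_comp_Some_iff on12_def on13_def on23_def)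
  obtain Q1 where
    Q1: "Q1 = 1 - b * z3 / (1 - y2 * z3)" "1 - y2 * z3 \<noteq> 0" "Q1 \<noteq> 0" and
    q'r': "q' = (z3 / Q1, z2 + y2 * (1 - Q1))" "r' = (y3 * Q1, y2 * Q1)"
    using R23' unfolding R_eq_Some_iff ab by blast
  obtain Q2 where
    Q2: "Q2 = 1 - (a + b) * (y3 * Q1) / (1 - x2 * (y3 * Q1))" "1 - x2 * (y3 * Q1) \<noteq> 0" and
    x't3: "x' = (y3 * Q1 / Q2, y2 * Q1 + x2 * (1 - Q2))" "t3 = (x3 * Q2, x2 * Q2)"
    using R13' unfolding q'r' R_eq_Some_iff ab by blast
  obtain Q3 where
    Q3: "Q3 = 1 - a * (z3 / Q1) / (1 - (y2 * Q1 + x2 * (1 - Q2)) * (z3 / Q1))" and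
    t12: "t1 = (z3 / Q1 / Q3, z2 + y2 * (1 - Q1) + (y2 * Q1 + x2 * (1 - Q2)) * (1 - Q3))"
      "t2 = (y3 * Q1 / Q2 * Q3, (y2 * Q1 + x2 * (1 - Q2)) * Q3)"
    using R12' unfolding x't3 q'r' R_eq_Some_iff ab by blast
  note rel = Ptilde_relations[OF P1(2) Q1(2) P1(1,3) P2(1,2) P3 Q1(1,3) Q2 Q3]
  \<comment> \<open>Label-2 coordinates of the first two outputs.  The second equation follows from the first because
    the sum of the two coordinates is \<open>z\<^sup>2 + y\<^sup>2 + x\<^sup>2 (1 - P1 P3)\<close> on the left and
    \<open>z\<^sup>2 + y\<^sup>2 + x\<^sup>2 (1 - Q2)\<close> on the right.\<close>
  have first: "(y2 + x2 * (1 - P1)) * (1 - P2) =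
      y2 * (1 - Q1) + (y2 * Q1 + x2 * (1 - Q2)) * (1 - Q3)"
  proof -
    have "(y2 + x2 * (1 - P1)) * (1 - P2) = y2 * (1 - P2) + x2 * ((1 - P1) * (1 - P2))"
      by (simp add: algebra_simps)
    also have "\<dots> = y2 * (1 - Q1 * Q3) + x2 * ((1 - Q2) * (1 - Q3))"
      unfolding rel(3) unfolding rel(2) ..
    finally show ?thesis by (simp add: algebra_simps)
  qed
  have second: "(y2 + x2 * (1 - P1)) * P2 + x2 * P1 * (1 - P3) =
      (y2 * Q1 + x2 * (1 - Q2)) * Q3"
  proof -
    have "(y2 + x2 * (1 - P1)) * P2 + x2 * P1 * (1 - P3) =
        y2 + x2 - (y2 + x2 * (1 - P1)) * (1 - P2) - x2 * (P1 * P3)"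
      by (simp add: algebra_simps)
    then show ?thesis by (simp only: first rel(1)) (simp add: algebra_simps)
  qed
  have "y3 / P1 * P2 / P3 = y3 * P2 / (P1 * P3)" by simp
  also have "\<dots> = y3 * Q1 / Q2 * Q3" by (simp only: rel) simp
  finally show ?thesis
    using first second rel by (simp add: s t s1r s23 x't3 t12 mult.assoc add.assoc)
qed

theorem mainTheorem3:
  fixes \<beta>1 \<beta>2 \<beta>3 :: complex
  shows "birational_map coords2 (R \<beta>1 \<beta>2)
    \<and> (\<forall>u v u1 v1 v2 u12 v12 :: complex.
         1 - u1 * v2 \<noteq> 0 \<longrightarrow> v \<noteq> 0 \<longrightarrow> v1 \<noteq> 0 \<longrightarrow> v12 \<noteq> 0 \<longrightarrow>
         u12 = u + (\<beta>1 - \<beta>2) / (1 - u1 * v2) * u1 \<longrightarrow>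
         v12 = v - (\<beta>1 - \<beta>2) / (1 - u1 * v2) * v2 \<longrightarrow>
         R \<beta>1 \<beta>2 ((v / v1, v * u1), (v2 / v, u * v2))
           = Some ((v2 / v12, v2 * u12), (v12 / v1, u1 * v12)))
    \<and> rational_eq coords3
         (on23 (R \<beta>2 \<beta>3) \<circ>\<^sub>m on13 (R \<beta>1 \<beta>3) \<circ>\<^sub>m on12 (R \<beta>1 \<beta>2))
         (on12 (R \<beta>1 \<beta>2) \<circ>\<^sub>m on13 (R \<beta>1 \<beta>3) \<circ>\<^sub>m on23 (R \<beta>2 \<beta>3))"
proof (intro conjI allI impI)
  show "birational_map coords2 (R \<beta>1 \<beta>2)" by (rule R_birational)
next
  fix u v u1 v1 v2 u12 v12 :: complex
  assume "1 - u1 * v2 \<noteq> 0" "v \<noteq> 0" "v1 \<noteq> 0" "v12 \<noteq> 0"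
    "u12 = u + (\<beta>1 - \<beta>2) / (1 - u1 * v2) * u1"
    "v12 = v - (\<beta>1 - \<beta>2) / (1 - u1 * v2) * v2"
  then show "R \<beta>1 \<beta>2 ((v / v1, v * u1), (v2 / v, u * v2))
      = Some ((v2 / v12, v2 * u12), (v12 / v1, u1 * v12))"
    by (rule R_square)
next
  show "rational_eq coords3
      (on23 (R \<beta>2 \<beta>3) \<circ>\<^sub>m on13 (R \<beta>1 \<beta>3) \<circ>\<^sub>m on12 (R \<beta>1 \<beta>2))
      (on12 (R \<beta>1 \<beta>2) \<circ>\<^sub>m on13 (R \<beta>1 \<beta>3) \<circ>\<^sub>m on23 (R \<beta>2 \<beta>3))"
  proof (rule regular_map_at_imp_rational_eq)
    note regular = R_regular[THEN on12_regular] R_regular[THEN on13_regular] R_regular[THEN on23_regular]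
    show "regular_map_at coords3 coords3 origin3 origin3
        (on23 (R \<beta>2 \<beta>3) \<circ>\<^sub>m on13 (R \<beta>1 \<beta>3) \<circ>\<^sub>m on12 (R \<beta>1 \<beta>2))"
      by (rule regular_map_at_comp[OF regular(1) regular_map_at_comp[OF regular(2,3)]])
    show "regular_map_at coords3 coords3 origin3 origin3
        (on12 (R \<beta>1 \<beta>2) \<circ>\<^sub>m on13 (R \<beta>1 \<beta>3) \<circ>\<^sub>m on23 (R \<beta>2 \<beta>3))"
      by (rule regular_map_at_comp[OF regular(3) regular_map_at_comp[OF regular(2,1)]])
  qed (rule R_yang_baxter_pointwise)
qed

end
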